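(* Any disagreement bound $f$ satisfies $$f\left(\tfrac1n\right)\ge \frac{2}{n+1}\qquad\text{for every integer } n\ge 1.$$ (Here $\frac{2}{n+1}=F(\frac1n)$ with $F(x)=\frac{2x}{1+x}$.) In particular, the function $x\mapsto \min(ax,1)$ on $[0,1]$ is a disagreement bound for $a=2$, but is not a disagreement bound for any $a<2$.
   Context: A coupling of a collection of random variables $(X_i)_{i\in I}$ is a family $(X_i')_{i\in I}$ of random variables on one common probability space such that each $X_i'$ has the same law as $X_i$; primes are omitted. The total variation distance is $d_{\mathrm{TV}}(X,Y)=\sup_A|\mathbb P(X\in A)-\mathbb P(Y\in A)|$, over all measurable sets $A$. A function $f:[0,1]\to[0,1]$ is called a disagreement bound if for any finite collection of random variables there is a coupling of the variables such that any two of them, say $X$ and $Y$, satisfy $\mathbb P(X\neq Y)\le f(d_{\mathrm{TV}}(X,Y))$. *)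

theory Defs
  imports "HOL-Probability.Probability"
begin

definition tv_dist :: "'a measure \<Rightarrow> 'a measure \<Rightarrow> real" where
  "tv_dist \<mu> \<nu> = (SUP A\<in>sets \<mu>. \<bar>measure \<mu> A - measure \<nu> A\<bar>)"

text \<open>
  A collection of random variables enters through its laws \<open>\<mu> i\<close>; couplings and total variation
  depend on nothing else, and every probability measure is a law.
\<close>

definition is_coupling ::
    "'i set \<Rightarrow> ('i \<Rightarrow> 'a measure) \<Rightarrow> 'w measure \<Rightarrow> ('i \<Rightarrow> 'w \<Rightarrow> 'a) \<Rightarrow> bool" where
  "is_coupling I \<mu> \<Omega> X \<longleftrightarrow>
     prob_space \<Omega> \<and> (\<forall>i\<in>I. X i \<in> measurable \<Omega> (\<mu> i) \<and> distr \<Omega> (\<mu> i) (X i) = \<mu> i)"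

text \<open>
  The type argument is the type carrying the value spaces \<open>S\<close>, which are otherwise arbitrary
  measurable spaces. A bound for all value spaces is one for every type; sharpness needs only a single
  infinite type (over \<open>bool\<close>, monotone coupling attains \<open>tv_dist\<close> itself).
  Finite collections are indexed by finite sets of naturals.

  The coupling may live on an arbitrary \<open>\<sigma>\<close>-algebra over \<open>nat \<Rightarrow> 'a\<close>. This is no restriction:
  a coupling on any \<open>\<Omega>\<close> is transported along \<open>\<omega> \<mapsto> (\<lambda>i. X i \<omega>)\<close>, giving the target the sets whose
  preimage is an event; this keeps the laws and the disagreement events.

  The disagreement set is explicitly required to be an event, since the diagonal of an arbitrary
  \<open>S\<close> need not be measurable and \<^const>\<open>measure\<close> is 0 on non-measurable sets.
\<close>

definition disagreement_bound :: "'a itself \<Rightarrow> (real \<Rightarrow> real) \<Rightarrow> bool" where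
  "disagreement_bound T f \<longleftrightarrow>
     f \<in> {0..1} \<rightarrow> {0..1} \<and>
     (\<forall>(S :: 'a measure) (I :: nat set) (\<mu> :: nat \<Rightarrow> 'a measure).
        finite I \<longrightarrow> (\<forall>i\<in>I. prob_space (\<mu> i) \<and> sets (\<mu> i) = sets S) \<longrightarrow>
        (\<exists>(\<Omega> :: (nat \<Rightarrow> 'a) measure) X.
           is_coupling I \<mu> \<Omega> X \<and>
           (\<forall>i\<in>I. \<forall>j\<in>I. i \<noteq> j \<longrightarrow>
              {\<omega> \<in> space \<Omega>. X i \<omega> \<noteq> X j \<omega>} \<in> sets \<Omega> \<and>
              measure \<Omega> {\<omega> \<in> space \<Omega>. X i \<omega> \<noteq> X j \<omega>} \<le> f (tv_dist (\<mu> i) (\<mu> j)))))"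

definition F :: "real \<Rightarrow> real" where
  "F x = 2 * x / (1 + x)"

end

theory Submission
  imports Defs
begin

text \<open>
  Lower bound: let \<open>X\<^sub>i\<close> be uniform on \<open>{x\<^sub>0, \<dots>, x\<^sub>n}\<close> without \<open>x\<^sub>i\<close>. All distances are \<open>1/n\<close>,
  and the \<open>X\<^sub>i\<close> are never all equal, since the common value \<open>x\<^sub>k\<close> would be missed by \<open>X\<^sub>k\<close>. So at least
  \<open>n\<close> of the \<open>n(n+1)/2\<close> pairs disagree, and some pair disagrees with probability at least \<open>2/(n+1)\<close>.

  Upper bound: throw a point uniformly at the union of the subgraphs of the densities \<open>p\<^sub>i\<close>, of total
  mass \<open>c\<close>. If it lies below \<open>p\<^sub>i\<close>, give its abscissa to \<open>X\<^sub>i\<close>; otherwise keep the value that \<open>X\<^sub>i\<close> has in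
  a previous coupling. This preserves the laws, and for two variables at distance \<open>d\<close> turns the
  disagreement probability \<open>b\<close> into at most \<open>2d/c + (1 - (1+d)/c) b\<close>, a contraction with fixed point
  \<open>2d/(1+d) = F(d)\<close>. If \<open>d > 0\<close> then \<open>F(d) < 2d\<close>, so that finitely many rounds suffice, and variables
  with \<open>d = 0\<close> are made equal from the start.

  The diagonal need not be measurable. Only a measurable superset of each disagreement set is
  controlled, and the measure is then extended to make the finitely many disagreement sets events.
\<close>

subsection \<open>Extending a probability measure to finitely many additional sets\<close>

text \<open>
  With \<open>H\<close> a measurable envelope of \<open>A\<close>, the extension lets the mass of \<open>H\<close> sit entirely on \<open>A\<close>: it maps
  \<open>F \<inter> A \<union> (G - A)\<close> to the sum of the measures of \<open>F \<inter> H\<close> and \<open>G - H\<close>.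
\<close>
lemma ex_measure_extension_insert:
  fixes M :: "'w measure"
  assumes "prob_space M" and AM: "A \<subseteq> space M"
  shows "\<exists>N. space N = space M \<and> sets M \<subseteq> sets N \<and> A \<in> sets N \<and>
             (\<forall>E\<in>sets M. emeasure N E = emeasure M E)"
proof -
  interpret prob_space M by fact
  obtain H where H: "H \<in> sets M" "A \<subseteq> H" "outer_measure_of M A = emeasure M H"
    using outer_measure_of_attain[OF AM] by blast
  \<comment> \<open>Since the measure is finite, a measurable superset of least measure is an
    envelope: it has the same trace measures as \<open>A\<close>, not only the same total.\<close>
  have env: "measurable_envelope M A H"
    using H by (subst measurable_envelope_eq2) (auto simp: less_top[symmetric])
  have H_trace: "outer_measure_of M (F \<inter> A) = emeasure M (F \<inter> H)" if "F \<in> sets M" for F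
    using measurable_envelopeD(3)[OF env that] by simp
  define \<A> where "\<A> = {F \<inter> A \<union> (G - A) | F G. F \<in> sets M \<and> G \<in> sets M}"
  \<comment> \<open>Expressed through \<open>E\<close> alone, so that independence of the choice of
    \<open>F\<close> and \<open>G\<close> is automatic; \<open>A \<subseteq> H\<close> turns the
    second term into the measure of \<open>G - H\<close>.\<close>
  define \<nu> where "\<nu> E = outer_measure_of M (E \<inter> A) + emeasure M (E - H)" for E
  have sub: "sets M \<subseteq> \<A>"
  proof
    fix E assume "E \<in> sets M"
    moreover have "E = E \<inter> A \<union> (E - A)" by auto
    ultimately show "E \<in> \<A>" unfolding \<A>_def by blast
  qed
  have seq: "\<exists>F G. (\<forall>n::nat. F n \<in> sets M \<and> G n \<in> sets M \<and> E n = F n \<inter> A \<union> (G n - A))"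
    if "range E \<subseteq> \<A>" for E
  proof -
    have "\<forall>n. \<exists>F G. F \<in> sets M \<and> G \<in> sets M \<and> E n = F \<inter> A \<union> (G - A)"
      using that unfolding \<A>_def by blast
    then show ?thesis by metis
  qed
  have sa: "sigma_algebra (space M) \<A>"
    unfolding sigma_algebra_iff2
  proof (intro conjI ballI allI impI)
    show "\<A> \<subseteq> Pow (space M)"
      using AM sets.sets_into_space unfolding \<A>_def by blast
    show "{} \<in> \<A>" using sub by auto
  next
    fix E assume "E \<in> \<A>"
    then obtain F G where FG: "F \<in> sets M" "G \<in> sets M" "E = F \<inter> A \<union> (G - A)"
      unfolding \<A>_def by blast
    then have "space M - E = (space M - F) \<inter> A \<union> ((space M - G) - A)"
      using AM by auto
    then show "space M - E \<in> \<A>"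
      using FG unfolding \<A>_def by blast
  next
    fix E :: "nat \<Rightarrow> 'w set" assume "range E \<subseteq> \<A>"
    then obtain F G where FG: "\<And>n. F n \<in> sets M" "\<And>n. G n \<in> sets M"
      "\<And>n. E n = F n \<inter> A \<union> (G n - A)"
      using seq by metis
    have "(\<Union>n. E n) = (\<Union>n. F n) \<inter> A \<union> ((\<Union>n. G n) - A)"
      using FG(3) by auto
    moreover have "(\<Union>n. F n) \<in> sets M" "(\<Union>n. G n) \<in> sets M"
      using FG(1,2) by auto
    ultimately show "(\<Union>n. E n) \<in> \<A>"
      unfolding \<A>_def by blast
  qed
  have ca: "countably_additive \<A> \<nu>"
  proof (rule countably_additiveI)
    fix E :: "nat \<Rightarrow> 'w set"
    assume "range E \<subseteq> \<A>" and disj: "disjoint_family E"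
    then obtain F G where FG: "\<And>n. F n \<in> sets M" "\<And>n. G n \<in> sets M"
      "\<And>n. E n = F n \<inter> A \<union> (G n - A)"
      using seq by metis
    \<comment> \<open>the \<open>F n\<close> may overlap outside \<open>A\<close>\<close>
    define F' where "F' = disjointed F"
    have F'_sets: "F' n \<in> sets M" for n
      unfolding F'_def using FG(1) sets.range_disjointed_sets[of F M] by blast
    have F'_disj: "disjoint_family F'"
      unfolding F'_def by (rule disjoint_family_disjointed)
    \<comment> \<open>The traces \<open>F n \<inter> A = E n \<inter> A\<close> are disjoint
      already, so making the sets disjoint removes nothing inside \<open>A\<close>.\<close>
    have E_A: "E n \<inter> A = F' n \<inter> A" for n
    proof -
      have "x \<notin> F m" if "m < n" "x \<in> F n" "x \<in> A" for m x
      proof -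
        have "E m \<inter> E n = {}"
          using disj \<open>m < n\<close> unfolding disjoint_family_on_def by auto
        then show ?thesis
          using that FG(3)[of m] FG(3)[of n] by auto
      qed
      then show ?thesis
        unfolding F'_def disjointed_def FG(3) by auto
    qed
    have E_H: "E n - H = G n - H" for n
      using FG(3)[of n] H(2) by auto
    have "(\<Sum>n. outer_measure_of M (E n \<inter> A)) = (\<Sum>n. emeasure M (F' n \<inter> H))"
      unfolding E_A by (simp add: H_trace F'_sets)
    also have "\<dots> = emeasure M (\<Union>n. F' n \<inter> H)"
      using F'_disj F'_sets H(1)
      by (intro suminf_emeasure) (auto simp: disjoint_family_on_def)
    also have "(\<Union>n. F' n \<inter> H) = (\<Union>n. F' n) \<inter> H" by auto
    also have "emeasure M \<dots> = outer_measure_of M ((\<Union>n. F' n) \<inter> A)"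
      using F'_sets by (intro H_trace[symmetric]) auto
    also have "(\<Union>n. F' n) \<inter> A = (\<Union>n. E n) \<inter> A"
      using E_A by blast
    finally have 1: "(\<Sum>n. outer_measure_of M (E n \<inter> A)) = outer_measure_of M ((\<Union>n. E n) \<inter> A)" .
    have "(\<Sum>n. emeasure M (E n - H)) = emeasure M (\<Union>n. E n - H)"
    proof (rule suminf_emeasure)
      show "range (\<lambda>n. E n - H) \<subseteq> sets M"
        using FG(2) H(1) by (auto simp: E_H)
      show "disjoint_family (\<lambda>n. E n - H)"
        using disj by (auto simp: disjoint_family_on_def)
    qed
    also have "(\<Union>n. E n - H) = (\<Union>n. E n) - H" by auto
    finally show "(\<Sum>n. \<nu> (E n)) = \<nu> (\<Union>n. E n)"
      unfolding \<nu>_def by (simp add: suminf_add[symmetric] 1)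
  qed
  have pos: "positive \<A> \<nu>"
    by (simp add: positive_def \<nu>_def)
  define N where "N = measure_of (space M) \<A> \<nu>"
  interpret sigma_algebra "space M" \<A> by (rule sa)
  have sets_N: "sets N = \<A>"
    unfolding N_def by (rule sets_measure_of_eq)
  have "space N = space M"
    unfolding N_def by (rule space_measure_of_eq)
  moreover have "A \<in> \<A>"
  proof -
    have "A = space M \<inter> A \<union> ({} - A)" using AM by auto
    then show ?thesis unfolding \<A>_def by blast
  qed
  moreover have "emeasure N E = emeasure M E" if E: "E \<in> sets M" for E
  proof -
    have "emeasure N E = \<nu> E"
      unfolding N_def using sub E by (intro emeasure_measure_of_sigma sa pos ca) auto
    also have "\<dots> = emeasure M (E \<inter> H) + emeasure M (E - H)"
      using E by (simp add: \<nu>_def H_trace)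
    also have "\<dots> = emeasure M (E \<inter> H \<union> (E - H))"
      using E H(1) by (intro plus_emeasure) auto
    also have "E \<inter> H \<union> (E - H) = E" by auto
    finally show ?thesis .
  qed
  ultimately show ?thesis
    using sub sets_N by blast
qed

lemma ex_measure_extension:
  fixes M :: "'w measure"
  assumes "finite \<D>" "prob_space M" "\<D> \<subseteq> Pow (space M)"
  shows "\<exists>N. space N = space M \<and> sets M \<subseteq> sets N \<and> \<D> \<subseteq> sets N \<and>
             (\<forall>E\<in>sets M. emeasure N E = emeasure M E)"
  using assms
proof (induction \<D> rule: finite_induct)
  case empty
  show ?case by (rule exI[of _ M]) auto
next
  case (insert D \<D>)
  then obtain N where N: "space N = space M" "sets M \<subseteq> sets N" "\<D> \<subseteq> sets N"
      "\<forall>E\<in>sets M. emeasure N E = emeasure M E"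
    by auto
  have "prob_space N"
    using N insert.prems(1) by (intro prob_spaceI) (simp add: prob_space.emeasure_space_1)
  then obtain N' where "space N' = space N" "sets N \<subseteq> sets N'" "D \<in> sets N'"
      "\<forall>E\<in>sets N. emeasure N' E = emeasure N E"
    using ex_measure_extension_insert[of N D] insert.prems N(1) by auto
  with N show ?case
    by (intro exI[of _ N']) auto
qed

subsection \<open>Couplings with prescribed disagreement probabilities\<close>

text \<open>The bound is a matrix over pairs of indices rather than a function of the distance,
  which lets it record the intermediate couplings of the iteration.\<close>

definition coupled_within :: "nat set \<Rightarrow> (nat \<Rightarrow> 'b measure) \<Rightarrow> (nat \<Rightarrow> nat \<Rightarrow> real) \<Rightarrow> bool" where
  "coupled_within I \<mu> b \<longleftrightarrow>
     (\<exists>(\<Omega> :: (nat \<Rightarrow> 'b) measure) X. is_coupling I \<mu> \<Omega> X \<and>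
        (\<forall>i\<in>I. \<forall>j\<in>I. {\<omega> \<in> space \<Omega>. X i \<omega> \<noteq> X j \<omega>} \<in> sets \<Omega> \<and>
           measure \<Omega> {\<omega> \<in> space \<Omega>. X i \<omega> \<noteq> X j \<omega>} \<le> b i j))"

lemma coupled_within_mono:
  assumes "coupled_within I \<mu> b" "\<And>i j. i \<in> I \<Longrightarrow> j \<in> I \<Longrightarrow> b i j \<le> b' i j"
  shows "coupled_within I \<mu> b'"
  using assms unfolding coupled_within_def by (meson order_trans)

text \<open>Allows couplings on any sample space with only measurable supersets \<open>B i j\<close>
  of the disagreement sets. First the measure is extended so that these sets become events; then
  everything is pushed forward along \<open>\<omega> \<mapsto> (\<lambda>i. X i \<omega>)\<close> to
  reach the sample type \<open>nat \<Rightarrow> 'b\<close>.\<close>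

lemma coupled_withinI:
  fixes \<Omega> :: "'w measure" and X :: "nat \<Rightarrow> 'w \<Rightarrow> 'b" and \<mu> :: "nat \<Rightarrow> 'b measure"
  assumes fin: "finite I" and coup: "is_coupling I \<mu> \<Omega> X"
    and B: "\<And>i j. i \<in> I \<Longrightarrow> j \<in> I \<Longrightarrow> B i j \<in> sets \<Omega>"
    and sub: "\<And>i j. i \<in> I \<Longrightarrow> j \<in> I \<Longrightarrow> {\<omega> \<in> space \<Omega>. X i \<omega> \<noteq> X j \<omega>} \<subseteq> B i j"
  shows "coupled_within I \<mu> (\<lambda>i j. measure \<Omega> (B i j))"
proof -
  have ps: "prob_space \<Omega>" and X: "\<And>i. i \<in> I \<Longrightarrow> X i \<in> measurable \<Omega> (\<mu> i)"
    and law: "\<And>i. i \<in> I \<Longrightarrow> distr \<Omega> (\<mu> i) (X i) = \<mu> i"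
    using coup unfolding is_coupling_def by auto
  define D where "D i j = {\<omega> \<in> space \<Omega>. X i \<omega> \<noteq> X j \<omega>}" for i j
  have "\<exists>N. space N = space \<Omega> \<and> sets \<Omega> \<subseteq> sets N \<and> (\<lambda>(i, j). D i j) ` (I \<times> I) \<subseteq> sets N \<and>
             (\<forall>E\<in>sets \<Omega>. emeasure N E = emeasure \<Omega> E)"
    using fin ps by (intro ex_measure_extension) (auto simp: D_def)
  then obtain N where N: "space N = space \<Omega>" "sets \<Omega> \<subseteq> sets N"
      "\<And>i j. i \<in> I \<Longrightarrow> j \<in> I \<Longrightarrow> D i j \<in> sets N"
      "\<And>E. E \<in> sets \<Omega> \<Longrightarrow> emeasure N E = emeasure \<Omega> E"
    by (auto simp: image_subset_iff)
  interpret N: prob_space N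
    using N ps by (intro prob_spaceI) (simp add: prob_space.emeasure_space_1)
  define \<phi> where "\<phi> \<omega> = (\<lambda>i. X i \<omega>)" for \<omega>
  \<comment> \<open>The largest \<sigma>-algebra making \<open>\<phi>\<close> measurable, so the
    disagreement sets on the image become events. The space is the image of \<open>\<phi>\<close> so
    that the coordinates take values in \<open>space (\<mu> i)\<close>.\<close>
  define \<T> where "\<T> = {A. A \<subseteq> \<phi> ` space N \<and> \<phi> -` A \<inter> space N \<in> sets N}"
  have sa: "sigma_algebra (\<phi> ` space N) \<T>"
    unfolding sigma_algebra_iff2
  proof (intro conjI ballI allI impI)
    show "\<T> \<subseteq> Pow (\<phi> ` space N)" "{} \<in> \<T>" by (auto simp: \<T>_def)
  next
    fix A assume "A \<in> \<T>"
    moreover have "\<phi> -` (\<phi> ` space N - A) \<inter> space N = space N - (\<phi> -` A \<inter> space N)"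
      by auto
    ultimately show "\<phi> ` space N - A \<in> \<T>"
      unfolding \<T>_def by auto
  next
    fix A :: "nat \<Rightarrow> _" assume "range A \<subseteq> \<T>"
    then have "(\<Union>n. \<phi> -` A n \<inter> space N) \<in> sets N" "(\<Union>n. A n) \<subseteq> \<phi> ` space N"
      by (auto simp: \<T>_def image_subset_iff simp del: UN_extend_simps UN_simps)
    moreover have "\<phi> -` (\<Union>n. A n) \<inter> space N = (\<Union>n. \<phi> -` A n \<inter> space N)"
      by auto
    ultimately show "(\<Union>n. A n) \<in> \<T>"
      unfolding \<T>_def mem_Collect_eq by presburger
  qed
  define T where "T = sigma (\<phi> ` space N) \<T>"
  have sets_T: "sets T = \<T>" and space_T: "space T = \<phi> ` space N"
    unfolding T_def using sa
    by (simp_all add: sigma_algebra.sets_measure_of_eq sigma_algebra.space_measure_of_eq)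
  have \<phi>: "\<phi> \<in> measurable N T"
    by (rule measurableI) (auto simp: sets_T space_T \<T>_def)
  define \<Omega>' where "\<Omega>' = distr N T \<phi>"
  have X'_meas: "(\<lambda>\<omega>. \<omega> i) \<in> measurable T (\<mu> i)" if i: "i \<in> I" for i
  proof (rule measurableI)
    show "x i \<in> space (\<mu> i)" if "x \<in> space T" for x
      using that measurable_space[OF X[OF i]] N(1) by (auto simp: space_T \<phi>_def)
  next
    fix A assume "A \<in> sets (\<mu> i)"
    then have "X i -` A \<inter> space N \<in> sets N"
      using measurable_sets[OF X[OF i]] N(1,2) by auto
    moreover have "\<phi> -` ((\<lambda>\<omega>. \<omega> i) -` A \<inter> space T) \<inter> space N = X i -` A \<inter> space N"
      by (auto simp: space_T \<phi>_def)
    ultimately show "(\<lambda>\<omega>. \<omega> i) -` A \<inter> space T \<in> sets T"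
      by (auto simp: sets_T \<T>_def space_T)
  qed
  have "is_coupling I \<mu> \<Omega>' (\<lambda>i \<omega>. \<omega> i)"
    unfolding is_coupling_def
  proof (intro conjI ballI)
    show "prob_space \<Omega>'"
      unfolding \<Omega>'_def by (rule N.prob_space_distr[OF \<phi>])
  next
    fix i assume i: "i \<in> I"
    show "(\<lambda>\<omega>. \<omega> i) \<in> measurable \<Omega>' (\<mu> i)"
      using X'_meas[OF i] by (simp add: \<Omega>'_def)
    have XN: "X i \<in> measurable N (\<mu> i)"
      using X[OF i] N(1,2) unfolding measurable_def by auto
    have "distr \<Omega>' (\<mu> i) (\<lambda>\<omega>. \<omega> i) = distr N (\<mu> i) (X i)"
      unfolding \<Omega>'_def using X'_meas[OF i] \<phi> by (simp add: distr_distr comp_def \<phi>_def)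
    also have "\<dots> = distr \<Omega> (\<mu> i) (X i)"
    proof (rule measure_eqI)
      fix A assume "A \<in> sets (distr N (\<mu> i) (X i))"
      then show "emeasure (distr N (\<mu> i) (X i)) A = emeasure (distr \<Omega> (\<mu> i) (X i)) A"
        using XN X[OF i] measurable_sets[OF X[OF i]] N(1,4) by (simp add: emeasure_distr)
    qed simp
    finally show "distr \<Omega>' (\<mu> i) (\<lambda>\<omega>. \<omega> i) = \<mu> i"
      using law[OF i] by simp
  qed
  moreover have "{\<omega> \<in> space \<Omega>'. \<omega> i \<noteq> \<omega> j} \<in> sets \<Omega>' \<and>
      measure \<Omega>' {\<omega> \<in> space \<Omega>'. \<omega> i \<noteq> \<omega> j} \<le> measure \<Omega> (B i j)"
    if ij: "i \<in> I" "j \<in> I" for i j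
  proof -
    let ?D' = "{\<omega> \<in> space \<Omega>'. \<omega> i \<noteq> \<omega> j}"
    have pre: "\<phi> -` ?D' \<inter> space N = D i j"
      by (auto simp: \<Omega>'_def space_T D_def N(1) \<phi>_def)
    have D': "?D' \<in> sets T"
      using N(3)[OF ij] pre by (auto simp: \<T>_def sets_T \<Omega>'_def space_T)
    have "measure \<Omega>' ?D' = measure N (D i j)"
      unfolding \<Omega>'_def using measure_distr[OF \<phi> D'] pre by (simp add: \<Omega>'_def)
    \<comment> \<open>The mass of \<open>D i j\<close> depends on the extension chosen, but
      \<open>B i j\<close> is an event of \<open>\<Omega>\<close> and keeps its measure.\<close>
    also have "\<dots> \<le> measure N (B i j)"
      using sub[OF ij] B[OF ij] N(2) by (intro N.finite_measure_mono) (auto simp: D_def)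
    also have "\<dots> = measure \<Omega> (B i j)"
      using N(4)[OF B[OF ij]] by (simp add: measure_def)
    finally show ?thesis
      using D' by (simp add: \<Omega>'_def)
  qed
  ultimately show ?thesis
    unfolding coupled_within_def by (intro exI[of _ \<Omega>'] exI[of _ "\<lambda>i \<omega>. \<omega> i"]) blast
qed

subsection \<open>Total variation distance\<close>

lemma tv_dist_ge:
  assumes "prob_space \<mu>" "prob_space \<nu>" "A \<in> sets \<mu>"
  shows "\<bar>measure \<mu> A - measure \<nu> A\<bar> \<le> tv_dist \<mu> \<nu>"
  unfolding tv_dist_def
proof (rule cSUP_upper[OF assms(3)])
  have "\<bar>measure \<mu> B - measure \<nu> B\<bar> \<le> 1" for B
    using prob_space.prob_le_1[OF assms(1), of B] prob_space.prob_le_1[OF assms(2), of B]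
      measure_nonneg[of \<mu> B] measure_nonneg[of \<nu> B] by linarith
  then show "bdd_above ((\<lambda>A. \<bar>measure \<mu> A - measure \<nu> A\<bar>) ` sets \<mu>)"
    by (auto intro!: bdd_aboveI)
qed

lemma tv_dist_nonneg:
  assumes "prob_space \<mu>" "prob_space \<nu>"
  shows "0 \<le> tv_dist \<mu> \<nu>"
  using tv_dist_ge[OF assms, of "{}"] by simp

lemma tv_dist_le_1:
  assumes "prob_space \<mu>" "prob_space \<nu>"
  shows "tv_dist \<mu> \<nu> \<le> 1"
  unfolding tv_dist_def
proof (rule cSUP_least)
  show "\<bar>measure \<mu> A - measure \<nu> A\<bar> \<le> 1" for A
    using prob_space.prob_le_1[OF assms(1), of A] prob_space.prob_le_1[OF assms(2), of A]
      measure_nonneg[of \<mu> A] measure_nonneg[of \<nu> A] by linarith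
qed auto

lemma tv_dist_self: "tv_dist \<mu> \<mu> = 0"
proof -
  have "sets \<mu> \<noteq> {}" by auto
  then show ?thesis by (simp add: tv_dist_def)
qed

lemma tv_dist_eq_0D:
  assumes "prob_space \<mu>" "prob_space \<nu>" "sets \<mu> = sets \<nu>" "tv_dist \<mu> \<nu> = 0"
  shows "\<mu> = \<nu>"
proof (rule measure_eqI[OF assms(3)])
  interpret \<mu>: prob_space \<mu> by fact
  interpret \<nu>: prob_space \<nu> by fact
  fix A assume "A \<in> sets \<mu>"
  then have "measure \<mu> A = measure \<nu> A"
    using tv_dist_ge[OF assms(1,2), of A] assms(4) by simp
  then show "emeasure \<mu> A = emeasure \<nu> A"
    by (simp add: \<mu>.emeasure_eq_measure \<nu>.emeasure_eq_measure)
qed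

subsection \<open>The upper bound\<close>

text \<open>The length of a vertical slice below a density. The condition \<open>0 < u\<close> is
  essential because \<open>ennreal\<close> sends negative reals to 0, and \<open>c\<close> may be
  infinite because the Radon-Nikodym densities are \<open>ennreal\<close>-valued.\<close>

lemma emeasure_lborel_Ioc_ennreal: "emeasure lborel {u. 0 < u \<and> ennreal u \<le> c} = c"
proof (cases c)
  case (real r)
  then have "{u. 0 < u \<and> ennreal u \<le> c} = {0<..r}" by auto
  then show ?thesis using real by simp
next
  case top
  then have "{u. 0 < u \<and> ennreal u \<le> c} = {0<..}" by auto
  moreover have "emeasure lborel {0 :: real<..} = \<top>"
  proof (rule ccontr)
    assume "emeasure lborel {0 :: real<..} \<noteq> \<top>"
    then obtain n where n: "emeasure lborel {0 :: real<..} < of_nat n"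
      using ennreal_Ex_less_of_nat less_top by blast
    have "emeasure lborel {0<..real n} \<le> emeasure lborel {0 :: real<..}"
      by (intro emeasure_mono) auto
    with n show False
      by (simp add: ennreal_of_nat_eq_real_of_nat)
  qed
  ultimately show ?thesis using top by simp
qed

text \<open>Supplies a common reference measure: each law is absolutely continuous with respect to
  the sum of all of them.\<close>

lemma ex_sum_measure:
  fixes \<mu> :: "'i \<Rightarrow> 'b measure"
  assumes "\<And>i. i \<in> I \<Longrightarrow> sets (\<mu> i) = sets S"
  shows "\<exists>L. sets L = sets S \<and> (\<forall>A\<in>sets S. emeasure L A = (\<Sum>i\<in>I. emeasure (\<mu> i) A))"
proof (intro exI conjI ballI)
  let ?L = "measure_of (space S) (sets S) (\<lambda>A. \<Sum>i\<in>I. emeasure (\<mu> i) A)"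
  show "sets ?L = sets S" by simp
  show "emeasure ?L A = (\<Sum>i\<in>I. emeasure (\<mu> i) A)" if "A \<in> sets S" for A
  proof (rule emeasure_measure_of_sigma[OF sets.sigma_algebra_axioms _ _ that])
    show "positive (sets S) (\<lambda>A. \<Sum>i\<in>I. emeasure (\<mu> i) A)"
      by (simp add: positive_def)
    show "countably_additive (sets S) (\<lambda>A. \<Sum>i\<in>I. emeasure (\<mu> i) A)"
      using assms by (intro countably_additiveI)
        (simp add: suminf_sum suminf_emeasure cong: sum.cong)
  qed
qed

text \<open>\<open>G i\<close> is the region below the density of \<open>\<mu> i\<close>,
  \<open>c\<close> the mass of the union of these regions, and \<open>Q\<close> the uniform
  distribution on the union. Each region has mass 1, hence \<open>1 \<le> c\<close>; given
  \<open>G i\<close>, the abscissa has law \<open>\<mu> i\<close>.\<close>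

lemma ex_acceptance_space:
  fixes \<mu> :: "nat \<Rightarrow> 'b measure"
  assumes fin: "finite I" and ne: "I \<noteq> {}"
    and laws: "\<forall>i\<in>I. prob_space (\<mu> i) \<and> sets (\<mu> i) = sets S"
  shows "\<exists>(Q :: ('b \<times> real) measure) G c. prob_space Q \<and> 1 \<le> c \<and> fst \<in> measurable Q S \<and>
    (\<forall>i\<in>I. G i \<in> sets Q \<and> (\<forall>E\<in>sets S. measure Q {y \<in> G i. fst y \<in> E} = measure (\<mu> i) E / c)) \<and>
    (\<forall>i\<in>I. \<forall>j\<in>I. measure Q (G i - G j) \<le> tv_dist (\<mu> i) (\<mu> j) / c)"
proof -
  have ps: "\<And>i. i \<in> I \<Longrightarrow> prob_space (\<mu> i)" and sets_\<mu>: "\<And>i. i \<in> I \<Longrightarrow> sets (\<mu> i) = sets S"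
    using laws by auto
  have space_\<mu>: "space (\<mu> i) = space S" if "i \<in> I" for i
    using sets_\<mu>[OF that] by (rule sets_eq_imp_space_eq)
  obtain L where sets_L: "sets L = sets S"
    and L: "\<And>A. A \<in> sets S \<Longrightarrow> emeasure L A = (\<Sum>i\<in>I. emeasure (\<mu> i) A)"
    using ex_sum_measure[of I \<mu> S] sets_\<mu> by blast
  have space_L: "space L = space S"
    using sets_L by (rule sets_eq_imp_space_eq)
  have "emeasure (\<mu> i) (space S) = 1" if "i \<in> I" for i
    using prob_space.emeasure_space_1[OF ps[OF that]] space_\<mu>[OF that] by simp
  then have "emeasure L (space L) = of_nat (card I)"
    by (simp add: space_L L)
  then interpret L: finite_measure L
    by (intro finite_measureI) simp
  have "\<exists>p. p \<in> borel_measurable L \<and> density L p = \<mu> i" if i: "i \<in> I" for i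
  proof -
    have "absolutely_continuous L (\<mu> i)"
      unfolding absolutely_continuous_def null_sets_def
      using i fin by (auto simp: sets_L L sets_\<mu>)
    then show ?thesis
      using L.Radon_Nikodym[of "\<mu> i"] i sets_\<mu> sets_L by auto
  qed
  then obtain p where p[measurable]: "\<And>i. i \<in> I \<Longrightarrow> p i \<in> borel_measurable L"
      and dens: "\<And>i. i \<in> I \<Longrightarrow> density L (p i) = \<mu> i"
    by metis
  define R where "R = L \<Otimes>\<^sub>M (lborel :: real measure)"
  define G where "G i = {y \<in> space R. 0 < snd y \<and> ennreal (snd y) \<le> p i (fst y)}" for i
  have G_sets: "G i \<in> sets R" if i: "i \<in> I" for i
    using p[OF i] unfolding G_def R_def by measurable
  have fst_R: "fst \<in> measurable R S"
    unfolding R_def using measurable_fst[of L lborel] sets_L by (simp cong: measurable_cong_sets)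
  have GE_sets: "{y \<in> G i. fst y \<in> E} \<in> sets R" if "i \<in> I" "E \<in> sets S" for i E
  proof -
    have "{y \<in> G i. fst y \<in> E} = G i \<inter> (fst -` E \<inter> space R)"
      by (auto simp: G_def)
    then show ?thesis
      using G_sets[OF that(1)] measurable_sets[OF fst_R that(2)] by auto
  qed
  have GE: "emeasure R {y \<in> G i. fst y \<in> E} = emeasure (\<mu> i) E" if i: "i \<in> I" and E: "E \<in> sets S" for i E
  proof -
    have "emeasure R {y \<in> G i. fst y \<in> E} =
        (\<integral>\<^sup>+x. emeasure lborel (Pair x -` {y \<in> G i. fst y \<in> E}) \<partial>L)"
      using GE_sets[OF that] unfolding R_def by (rule lborel.emeasure_pair_measure_alt)
    also have "\<dots> = (\<integral>\<^sup>+x. p i x * indicator E x \<partial>L)"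
    proof (rule nn_integral_cong)
      fix x assume x: "x \<in> space L"
      have "Pair x -` {y \<in> G i. fst y \<in> E} =
          (if x \<in> E then {u. 0 < u \<and> ennreal u \<le> p i x} else {})"
        using x by (auto simp: G_def R_def space_pair_measure)
      then show "emeasure lborel (Pair x -` {y \<in> G i. fst y \<in> E}) = p i x * indicator E x"
        by (simp add: emeasure_lborel_Ioc_ennreal)
    qed
    also have "\<dots> = emeasure (density L (p i)) E"
      using p[OF i] E sets_L by (simp add: emeasure_density)
    finally show ?thesis
      using dens[OF i] by simp
  qed
  have mGE: "measure R {y \<in> G i. fst y \<in> E} = measure (\<mu> i) E" if "i \<in> I" "E \<in> sets S" for i E
    using GE[OF that] by (simp add: measure_def)
  have G1: "emeasure R (G i) = 1" if i: "i \<in> I" for i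
  proof -
    have "{y \<in> G i. fst y \<in> space S} = G i"
      by (auto simp: G_def R_def space_pair_measure space_L)
    then show ?thesis
      using GE[OF i, of "space S"] prob_space.emeasure_space_1[OF ps[OF i]] space_\<mu>[OF i] by simp
  qed
  define V where "V = (\<Union>i\<in>I. G i)"
  have V_sets: "V \<in> sets R"
    unfolding V_def using fin G_sets by auto
  have "emeasure R V \<le> (\<Sum>i\<in>I. emeasure R (G i))"
    unfolding V_def using fin G_sets by (intro emeasure_subadditive_finite) auto
  also have "\<dots> = of_nat (card I)"
    using G1 by simp
  finally have V_fin: "emeasure R V \<noteq> \<infinity>"
    using less_top[of "of_nat (card I) :: ennreal"] by (auto simp: top_unique)
  obtain i0 where i0: "i0 \<in> I" using ne by blast
  have "1 \<le> emeasure R V"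
    using emeasure_mono[of "G i0" V R] i0 V_sets G1[OF i0] by (auto simp: V_def)
  then have V_1: "1 \<le> measure R V"
    using V_fin by (simp add: emeasure_eq_ennreal_measure)
  have V_0: "emeasure R V \<noteq> 0"
    using \<open>1 \<le> emeasure R V\<close> by auto
  define Q where "Q = uniform_measure R V"
  have sets_Q: "sets Q = sets R"
    by (simp add: Q_def)
  have prob_Q: "prob_space Q"
    unfolding Q_def using V_0 V_fin by (rule prob_space_uniform_measure)
  have mQ: "measure Q A = measure R A / measure R V" if "A \<in> sets R" "A \<subseteq> V" for A
    unfolding Q_def using that V_fin V_0 V_sets
    by (subst measure_uniform_measure) (auto simp: Int_absorb1)
  have diff: "measure R (G i - G j) \<le> tv_dist (\<mu> i) (\<mu> j)" if i: "i \<in> I" and j: "j \<in> I" for i j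
  proof -
    \<comment> \<open>All of \<open>G i - G j\<close> lies over \<open>E\<close>, and over
      \<open>E\<close> the region \<open>G j\<close> is contained in \<open>G i\<close>. The
      difference therefore has mass
      \<open>measure (\<mu> i) E - measure (\<mu> j) E\<close>.\<close>
    define E where "E = {x \<in> space L. p j x < p i x}"
    have E: "E \<in> sets S"
      using p[OF i] p[OF j] unfolding sets_L[symmetric] E_def by measurable
    have "{y \<in> G i. fst y \<in> E} = (G i - G j) \<union> {y \<in> G j. fst y \<in> E}"
      by (auto simp: G_def E_def R_def space_pair_measure)
    moreover have "(G i - G j) \<inter> {y \<in> G j. fst y \<in> E} = {}"
      by auto
    moreover have "emeasure R (G i - G j) \<noteq> \<infinity>" "emeasure R {y \<in> G j. fst y \<in> E} \<noteq> \<infinity>"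
      using emeasure_mono[of "G i - G j" "G i" R] emeasure_mono[of "{y \<in> G j. fst y \<in> E}" "G j" R]
        G_sets i j G1 by (auto simp: top_unique)
    ultimately have "measure R {y \<in> G i. fst y \<in> E} =
        measure R (G i - G j) + measure R {y \<in> G j. fst y \<in> E}"
      using G_sets i j GE_sets[OF j E] by (simp add: measure_Union)
    then have "measure R (G i - G j) = measure (\<mu> i) E - measure (\<mu> j) E"
      using mGE i j E by simp
    also have "\<dots> \<le> tv_dist (\<mu> i) (\<mu> j)"
      using tv_dist_ge[OF ps[OF i] ps[OF j], of E] E sets_\<mu>[OF i] by simp
    finally show ?thesis .
  qed
  show ?thesis
  proof (intro exI[of _ Q] exI[of _ G] exI[of _ "measure R V"] conjI ballI prob_Q V_1)
    show "fst \<in> measurable Q S"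
      using fst_R sets_Q by (simp cong: measurable_cong_sets)
  next
    fix i assume i: "i \<in> I"
    show "G i \<in> sets Q" using G_sets[OF i] sets_Q by simp
    fix E assume E: "E \<in> sets S"
    have "{y \<in> G i. fst y \<in> E} \<subseteq> V" using i by (auto simp: V_def)
    then show "measure Q {y \<in> G i. fst y \<in> E} = measure (\<mu> i) E / measure R V"
      using mQ[OF GE_sets[OF i E]] mGE[OF i E] by simp
  next
    fix i j assume ij: "i \<in> I" "j \<in> I"
    have "measure Q (G i - G j) = measure R (G i - G j) / measure R V"
      using ij G_sets by (intro mQ) (auto simp: V_def)
    also have "\<dots> \<le> tv_dist (\<mu> i) (\<mu> j) / measure R V"
      using diff[OF ij] V_1 by (intro divide_right_mono) auto
    finally show "measure Q (G i - G j) \<le> tv_dist (\<mu> i) (\<mu> j) / measure R V" .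
  qed
qed

section \<open>One round of acceptance or fallback to the previous coupling\<close>

text \<open>A fresh point from \<open>Q\<close> is drawn independently of the old coupling. If both
  variables accept it, they agree; if exactly one does, they are counted as disagreeing; if neither
  does, the old disagreement probability applies.\<close>

lemma coupled_within_step:
  fixes \<mu> :: "nat \<Rightarrow> 'b measure" and Q :: "('b \<times> real) measure"
  assumes fin: "finite I"
    and ps: "\<And>i. i \<in> I \<Longrightarrow> prob_space (\<mu> i)" and sets_\<mu>: "\<And>i. i \<in> I \<Longrightarrow> sets (\<mu> i) = sets S"
    and Q: "prob_space Q" and c: "1 \<le> c" and fst_Q: "fst \<in> measurable Q S"
    and G: "\<And>i. i \<in> I \<Longrightarrow> G i \<in> sets Q"
    and GE: "\<And>i E. i \<in> I \<Longrightarrow> E \<in> sets S \<Longrightarrow> measure Q {y \<in> G i. fst y \<in> E} = measure (\<mu> i) E / c"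
    and diff: "\<And>i j. i \<in> I \<Longrightarrow> j \<in> I \<Longrightarrow> measure Q (G i - G j) \<le> tv_dist (\<mu> i) (\<mu> j) / c"
    and within: "coupled_within I \<mu> b" and b2: "\<And>i j. i \<in> I \<Longrightarrow> j \<in> I \<Longrightarrow> b i j \<le> 2"
  shows "coupled_within I \<mu> (\<lambda>i j. 2 * tv_dist (\<mu> i) (\<mu> j) / c +
           (1 - (1 + tv_dist (\<mu> i) (\<mu> j)) / c) * b i j)"
proof -
  obtain \<Omega> :: "(nat \<Rightarrow> 'b) measure" and X where coup: "is_coupling I \<mu> \<Omega> X"
    and D: "\<And>i j. i \<in> I \<Longrightarrow> j \<in> I \<Longrightarrow> {\<omega> \<in> space \<Omega>. X i \<omega> \<noteq> X j \<omega>} \<in> sets \<Omega>"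
    and b: "\<And>i j. i \<in> I \<Longrightarrow> j \<in> I \<Longrightarrow> measure \<Omega> {\<omega> \<in> space \<Omega>. X i \<omega> \<noteq> X j \<omega>} \<le> b i j"
    using within unfolding coupled_within_def by blast
  interpret Q: prob_space Q by fact
  interpret \<Omega>: prob_space \<Omega> using coup by (simp add: is_coupling_def)
  have X: "X i \<in> measurable \<Omega> (\<mu> i)" and law: "distr \<Omega> (\<mu> i) (X i) = \<mu> i" if "i \<in> I" for i
    using coup that unfolding is_coupling_def by auto
  have space_\<mu>: "space (\<mu> i) = space S" if "i \<in> I" for i
    using sets_\<mu>[OF that] by (rule sets_eq_imp_space_eq)
  define P where "P = Q \<Otimes>\<^sub>M \<Omega>"
  interpret P: prob_space P
    unfolding P_def using Q \<Omega>.prob_space_axioms by (rule prob_space_pair)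
  have space_P: "space P = space Q \<times> space \<Omega>"
    by (simp add: P_def space_pair_measure)
  have mP: "measure P (A \<times> B) = measure Q A * measure \<Omega> B" if "A \<in> sets Q" "B \<in> sets \<Omega>" for A B
    unfolding P_def using \<Omega>.emeasure_pair_measure_Times[OF that] by (simp add: measure_def enn2real_mult)
  have sP: "A \<times> B \<in> sets P" if "A \<in> sets Q" "B \<in> sets \<Omega>" for A B
    unfolding P_def using that by auto
  have GE_sets: "{y \<in> G i. fst y \<in> E} \<in> sets Q" if "i \<in> I" "E \<in> sets S" for i E
  proof -
    have "{y \<in> G i. fst y \<in> E} = G i \<inter> (fst -` E \<inter> space Q)"
      using sets.sets_into_space[OF G[OF that(1)]] by auto
    then show ?thesis
      using G[OF that(1)] measurable_sets[OF fst_Q that(2)] by auto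
  qed
  have mG: "measure Q (G i) = 1 / c" if i: "i \<in> I" for i
  proof -
    have "{y \<in> G i. fst y \<in> space S} = G i"
      using sets.sets_into_space[OF G[OF i]] measurable_space[OF fst_Q] by auto
    then show ?thesis
      using GE[OF i, of "space S"] prob_space.prob_space[OF ps[OF i]] space_\<mu>[OF i] by simp
  qed
  define Y where "Y i = (\<lambda>z. if z \<in> G i \<times> space \<Omega> then fst (fst z) else X i (snd z))" for i
  have Y_meas: "Y i \<in> measurable P (\<mu> i)" if i: "i \<in> I" for i
    unfolding Y_def
  proof (rule measurable_If_set)
    have "fst \<in> measurable Q (\<mu> i)"
      using fst_Q sets_\<mu>[OF i] by (simp cong: measurable_cong_sets)
    then show "(\<lambda>z. fst (fst z)) \<in> measurable P (\<mu> i)"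
      unfolding P_def by measurable
    show "(\<lambda>z. X i (snd z)) \<in> measurable P (\<mu> i)"
      using X[OF i] unfolding P_def by measurable
    show "G i \<times> space \<Omega> \<inter> space P \<in> sets P"
      using sP[OF G[OF i], of "space \<Omega>"] by auto
  qed
  have Y_law: "distr P (\<mu> i) (Y i) = \<mu> i" if i: "i \<in> I" for i
  proof (rule measure_eqI)
    fix E assume "E \<in> sets (distr P (\<mu> i) (Y i))"
    then have E: "E \<in> sets (\<mu> i)" "E \<in> sets S"
      using sets_\<mu>[OF i] by auto
    have XE: "X i -` E \<inter> space \<Omega> \<in> sets \<Omega>"
      using measurable_sets[OF X[OF i] E(1)] .
    have mXE: "measure \<Omega> (X i -` E \<inter> space \<Omega>) = measure (\<mu> i) E"
      using measure_distr[OF X[OF i] E(1)] law[OF i] by simp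
    have "Y i -` E \<inter> space P =
        {y \<in> G i. fst y \<in> E} \<times> space \<Omega> \<union> (space Q - G i) \<times> (X i -` E \<inter> space \<Omega>)"
      using sets.sets_into_space[OF G[OF i]] by (auto simp: Y_def space_P split: if_splits)
    also have "measure P \<dots> = measure P ({y \<in> G i. fst y \<in> E} \<times> space \<Omega>) +
        measure P ((space Q - G i) \<times> (X i -` E \<inter> space \<Omega>))"
      using GE_sets[OF i E(2)] XE G[OF i]
      by (intro P.finite_measure_Union sP) auto
    \<comment> \<open>Acceptance with abscissa in \<open>E\<close>, plus rejection, of probability
      \<open>1 - 1 / c\<close>, times the independent old probability of \<open>E\<close>.\<close>
    also have "\<dots> = measure (\<mu> i) E / c + (1 - 1 / c) * measure (\<mu> i) E"
      using GE_sets[OF i E(2)] XE G[OF i]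
      by (simp add: mP GE[OF i E(2)] \<Omega>.prob_space Q.prob_compl mG[OF i] mXE)
    also have "\<dots> = measure (\<mu> i) E"
      by (simp add: algebra_simps)
    finally show "emeasure (distr P (\<mu> i) (Y i)) E = emeasure (\<mu> i) E"
      using emeasure_distr[OF Y_meas[OF i] E(1)] P.emeasure_eq_measure
        finite_measure.emeasure_eq_measure[OF prob_space.finite_measure[OF ps[OF i]]]
      by simp
  qed simp
  \<comment> \<open>Acceptance by exactly one variable is included entirely, since the points where
    the abscissa differs from the other old value need not form an event.\<close>
  define B where "B i j = ((G i - G j) \<union> (G j - G i)) \<times> space \<Omega> \<union>
      (space Q - (G i \<union> G j)) \<times> {\<omega> \<in> space \<Omega>. X i \<omega> \<noteq> X j \<omega>}" for i j
  have "is_coupling I \<mu> P Y"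
    unfolding is_coupling_def using Y_meas Y_law P.prob_space_axioms by auto
  moreover have "B i j \<in> sets P" if "i \<in> I" "j \<in> I" for i j
    unfolding B_def using G D that by (intro sets.Un sP) auto
  moreover have "{z \<in> space P. Y i z \<noteq> Y j z} \<subseteq> B i j" for i j
    by (auto simp: Y_def B_def space_P split: if_splits)
  ultimately have "coupled_within I \<mu> (\<lambda>i j. measure P (B i j))"
    by (intro coupled_withinI[OF fin])
  then show ?thesis
  proof (rule coupled_within_mono)
    show "measure P (B i j) \<le> 2 * tv_dist (\<mu> i) (\<mu> j) / c + (1 - (1 + tv_dist (\<mu> i) (\<mu> j)) / c) * b i j"
      if i: "i \<in> I" and j: "j \<in> I" for i j
    proof -
      define m where "m = measure \<Omega> {\<omega> \<in> space \<Omega>. X i \<omega> \<noteq> X j \<omega>}"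
      define a where "a = measure Q (G i - G j)"
      have un: "measure Q (G i \<union> G j) = measure Q (G j) + a"
        using Q.finite_measure_Union[of "G j" "G i - G j"] G i j by (simp add: a_def Un_commute)
      have "measure Q (G i \<union> G j) = measure Q (G i) + measure Q (G j - G i)"
        using Q.finite_measure_Union[of "G i" "G j - G i"] G i j by simp
      \<comment> \<open>Both regions have mass \<open>1 / c\<close>, so the two one-sided
        differences have equal mass.\<close>
      then have a': "measure Q (G j - G i) = a"
        using un mG i j by simp
      have sym: "measure Q ((G i - G j) \<union> (G j - G i)) = 2 * a"
        using Q.finite_measure_Union[of "G i - G j" "G j - G i"] G i j a' by (auto simp: a_def)
      have "measure P (B i j) \<le> measure P (((G i - G j) \<union> (G j - G i)) \<times> space \<Omega>) +
          measure P ((space Q - (G i \<union> G j)) \<times> {\<omega> \<in> space \<Omega>. X i \<omega> \<noteq> X j \<omega>})"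
        unfolding B_def using G D i j by (intro measure_Un_le sP) auto
      also have "\<dots> = measure Q ((G i - G j) \<union> (G j - G i)) * measure \<Omega> (space \<Omega>) +
          measure Q (space Q - (G i \<union> G j)) * m"
        unfolding m_def using G D i j by (intro arg_cong2[where f = "(+)"] mP) auto
      also have "\<dots> = 2 * a + (1 - (1 / c + a)) * m"
        using G i j by (simp only: sym Q.prob_compl[of "G i \<union> G j"] sets.Un un mG \<Omega>.prob_space)
      also have "\<dots> \<le> 2 * a + (1 - (1 / c + a)) * b i j"
        using b[OF i j] Q.prob_le_1[of "G i \<union> G j"] un mG[OF j]
        by (intro add_left_mono mult_left_mono) (auto simp: m_def)
      \<comment> \<open>Only an upper bound for \<open>a\<close> is known, and \<open>a\<close>
        occurs with both signs. Collected, its coefficient \<open>2 - b i j\<close> is nonnegative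
        by \<open>b2\<close>, so the bound can be inserted.\<close>
      also have "\<dots> = (2 - b i j) * a + (1 - 1 / c) * b i j"
        by (simp add: algebra_simps)
      also have "\<dots> \<le> (2 - b i j) * (tv_dist (\<mu> i) (\<mu> j) / c) + (1 - 1 / c) * b i j"
        using diff[OF i j] b2[OF i j]
        by (intro add_right_mono mult_left_mono) (auto simp: a_def)
      also have "\<dots> = 2 * tv_dist (\<mu> i) (\<mu> j) / c + (1 - (1 + tv_dist (\<mu> i) (\<mu> j)) / c) * b i j"
        using c by (simp add: field_simps)
      finally show ?thesis .
    qed
  qed
qed

section \<open>The starting coupling and the iteration\<close>

text \<open>One independent variable is taken per distinct law, at the least index
  \<open>r i\<close> carrying it, and shared by all indices with that law. Equal laws need
  disagreement exactly 0, as distance 0 leaves no room for the error of the iteration.\<close>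

lemma coupled_within_identifying_equal_laws:
  fixes \<mu> :: "nat \<Rightarrow> 'b measure"
  assumes fin: "finite I" and ps: "\<And>i. i \<in> I \<Longrightarrow> prob_space (\<mu> i)"
  shows "coupled_within I \<mu> (\<lambda>i j. if \<mu> i = \<mu> j then 0 else 1)"
proof -
  define r where "r i = (LEAST k. k \<in> I \<and> \<mu> k = \<mu> i)" for i
  have r: "r i \<in> I" "\<mu> (r i) = \<mu> i" if "i \<in> I" for i
    using LeastI[of "\<lambda>k. k \<in> I \<and> \<mu> k = \<mu> i" i] that by (auto simp: r_def)
  have r_eq: "r i = r j" if "\<mu> i = \<mu> j" for i j
    using that by (simp add: r_def)
  define P where "P = PiM I \<mu>"
  interpret P: prob_space P
    unfolding P_def using ps by (rule prob_space_PiM)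
  define B where "B i j = (if \<mu> i = \<mu> j then {} else space P)" for i j
  have "is_coupling I \<mu> P (\<lambda>i \<omega>. \<omega> (r i))"
    unfolding is_coupling_def
  proof (intro conjI ballI P.prob_space_axioms)
    fix i assume i: "i \<in> I"
    show "(\<lambda>\<omega>. \<omega> (r i)) \<in> measurable P (\<mu> i)"
      unfolding P_def using measurable_component_singleton[of "r i" I \<mu>] r[OF i] by simp
    show "distr P (\<mu> i) (\<lambda>\<omega>. \<omega> (r i)) = \<mu> i"
      unfolding P_def using distr_PiM_component[of I \<mu> "r i"] ps r[OF i] by simp
  qed
  moreover have "B i j \<in> sets P" for i j
    by (simp add: B_def)
  moreover have "{\<omega> \<in> space P. \<omega> (r i) \<noteq> \<omega> (r j)} \<subseteq> B i j" for i j
    using r_eq[of i j] by (auto simp: B_def)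
  ultimately have "coupled_within I \<mu> (\<lambda>i j. measure P (B i j))"
    by (intro coupled_withinI[OF fin])
  moreover have "measure P (B i j) = (if \<mu> i = \<mu> j then 0 else 1)" for i j
    by (simp add: B_def P.prob_space)
  ultimately show ?thesis by simp
qed

text \<open>For distance \<open>d\<close>, one round acts on the bound as an affine map with fixed
  point \<open>F d\<close> and slope \<open>1 - (1 + d) / c\<close>. The weaker factor
  \<open>1 - 1 / c\<close> is common to all pairs, and the start gives error at most 1. Pairs with
  equal laws stay at 0.\<close>

lemma coupled_within_approx_F:
  fixes \<mu> :: "nat \<Rightarrow> 'b measure"
  assumes fin: "finite I" and ne: "I \<noteq> {}"
    and laws: "\<forall>i\<in>I. prob_space (\<mu> i) \<and> sets (\<mu> i) = sets S"
  shows "\<exists>c\<ge>1. \<forall>n. coupled_within I \<mu>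
    (\<lambda>i j. if \<mu> i = \<mu> j then 0 else F (tv_dist (\<mu> i) (\<mu> j)) + (1 - 1 / c) ^ n)"
proof -
  have ps: "\<And>i. i \<in> I \<Longrightarrow> prob_space (\<mu> i)" and sets_\<mu>: "\<And>i. i \<in> I \<Longrightarrow> sets (\<mu> i) = sets S"
    using laws by auto
  obtain Q :: "('b \<times> real) measure" and G c where
    Q: "prob_space Q" and c: "1 \<le> c" and fst_Q: "fst \<in> measurable Q S"
    and G: "\<And>i. i \<in> I \<Longrightarrow> G i \<in> sets Q"
    and GE: "\<And>i E. i \<in> I \<Longrightarrow> E \<in> sets S \<Longrightarrow> measure Q {y \<in> G i. fst y \<in> E} = measure (\<mu> i) E / c"
    and diff: "\<And>i j. i \<in> I \<Longrightarrow> j \<in> I \<Longrightarrow> measure Q (G i - G j) \<le> tv_dist (\<mu> i) (\<mu> j) / c"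
    using ex_acceptance_space[OF fin ne laws] by blast
  have "coupled_within I \<mu>
    (\<lambda>i j. if \<mu> i = \<mu> j then 0 else F (tv_dist (\<mu> i) (\<mu> j)) + (1 - 1 / c) ^ n)" for n
  proof (induction n)
    case 0
    have "F (tv_dist (\<mu> i) (\<mu> j)) \<ge> 0" if "i \<in> I" "j \<in> I" for i j
      using tv_dist_nonneg[OF ps ps] that by (simp add: F_def)
    then show ?case
      by (intro coupled_within_mono[OF coupled_within_identifying_equal_laws[OF fin ps]]) auto
  next
    case (Suc n)
    define b where "b i j = (if \<mu> i = \<mu> j then 0 else F (tv_dist (\<mu> i) (\<mu> j)) + (1 - 1 / c) ^ n)" for i j
    \<comment> \<open>One unit from \<open>F\<close> and one from the error; this is why the round
      was stated for bounds up to 2 rather than 1.\<close>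
    have "b i j \<le> 2" if "i \<in> I" "j \<in> I" for i j
    proof -
      have "F (tv_dist (\<mu> i) (\<mu> j)) \<le> 1"
        using tv_dist_nonneg[OF ps ps] tv_dist_le_1[OF ps ps] that
        by (simp add: F_def divide_le_eq add_nonneg_pos add_pos_nonneg)
      moreover have "(1 - 1 / c) ^ n \<le> 1"
        using c by (intro power_le_one) auto
      ultimately show ?thesis by (simp add: b_def)
    qed
    moreover have "coupled_within I \<mu> b"
      using Suc by (simp add: b_def[abs_def])
    ultimately have "coupled_within I \<mu> (\<lambda>i j. 2 * tv_dist (\<mu> i) (\<mu> j) / c +
           (1 - (1 + tv_dist (\<mu> i) (\<mu> j)) / c) * b i j)"
      by (intro coupled_within_step[OF fin ps sets_\<mu> Q c fst_Q G GE diff]) auto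
    then show ?case
    proof (rule coupled_within_mono)
      show "2 * tv_dist (\<mu> i) (\<mu> j) / c + (1 - (1 + tv_dist (\<mu> i) (\<mu> j)) / c) * b i j \<le>
           (if \<mu> i = \<mu> j then 0 else F (tv_dist (\<mu> i) (\<mu> j)) + (1 - 1 / c) ^ Suc n)"
        if i: "i \<in> I" and j: "j \<in> I" for i j
      proof (cases "\<mu> i = \<mu> j")
        case True
        then show ?thesis
          by (simp add: b_def tv_dist_self)
      next
        case False
        define d where "d = tv_dist (\<mu> i) (\<mu> j)"
        define q where "q = (1 - 1 / c) ^ n"
        have "0 \<le> d" "0 \<le> q"
          using tv_dist_nonneg[OF ps[OF i] ps[OF j]] c by (simp_all add: d_def q_def)
        have "F d * (1 + d) = 2 * d"
          using \<open>0 \<le> d\<close> by (simp add: F_def)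
        \<comment> \<open>\<open>F d\<close> reproduces itself, and the error \<open>q\<close> is
          multiplied by \<open>1 - (1 + d) / c\<close>; the term \<open>d * q / c\<close> is dropped
          afterwards.\<close>
        then have "2 * d / c + (1 - (1 + d) / c) * (F d + q) = F d + (1 - 1 / c) * q - d * q / c"
          using c by (simp add: field_simps)
        also have "\<dots> \<le> F d + (1 - 1 / c) * q"
          using c \<open>0 \<le> d\<close> \<open>0 \<le> q\<close> by simp
        finally show ?thesis
          using False by (simp add: b_def d_def q_def)
      qed
    qed
  qed
  with c show ?thesis by blast
qed

lemma coupled_within_min_1:
  assumes "coupled_within I \<mu> b"
  shows "coupled_within I \<mu> (\<lambda>i j. min (b i j) 1)"
proof -
  have "measure \<Omega> A \<le> min x 1" if "is_coupling I \<mu> \<Omega> X" "measure \<Omega> A \<le> x"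
    for \<Omega> :: "(nat \<Rightarrow> _) measure" and X A x
    using that by (simp add: is_coupling_def prob_space.prob_le_1)
  with assms show ?thesis
    unfolding coupled_within_def by meson
qed

text \<open>For distinct laws the gap \<open>2 * d - F d\<close> equals
  \<open>2 * d^2 / (1 + d)\<close> and is positive. With finitely many pairs, one number of rounds
  brings every error below its gap, so no limit of couplings has to be taken.\<close>

lemma disagreement_bound_double:
  "disagreement_bound TYPE('b) (\<lambda>x. min (2 * x) 1)"
  unfolding disagreement_bound_def
proof (intro conjI allI impI)
  show "(\<lambda>x :: real. min (2 * x) 1) \<in> {0..1} \<rightarrow> {0..1}" by auto
next
  fix S :: "'b measure" and I :: "nat set" and \<mu> :: "nat \<Rightarrow> 'b measure"
  assume fin: "finite I" and laws: "\<forall>i\<in>I. prob_space (\<mu> i) \<and> sets (\<mu> i) = sets S"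
  then have ps: "\<And>i. i \<in> I \<Longrightarrow> prob_space (\<mu> i)" and sets_\<mu>: "\<And>i. i \<in> I \<Longrightarrow> sets (\<mu> i) = sets S"
    by auto
  have "coupled_within I \<mu> (\<lambda>i j. min (2 * tv_dist (\<mu> i) (\<mu> j)) 1)"
  proof (cases "I = {}")
    case True
    \<comment> \<open>Without variables any probability space serves; the acceptance space requires
      a nonempty union of regions.\<close>
    have "prob_space (return (count_space UNIV) undefined :: (nat \<Rightarrow> 'b) measure)"
      by (rule prob_space_return) simp
    with True show ?thesis
      unfolding is_coupling_def coupled_within_def by blast
  next
    case False
    obtain c where c: "1 \<le> c" and approx: "\<And>n. coupled_within I \<mu>
        (\<lambda>i j. if \<mu> i = \<mu> j then 0 else F (tv_dist (\<mu> i) (\<mu> j)) + (1 - 1 / c) ^ n)"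
      using coupled_within_approx_F[OF fin False laws] by blast
    have lim: "(\<lambda>n. (1 - 1 / c) ^ n) \<longlonglongrightarrow> 0"
      using c by (intro LIMSEQ_realpow_zero) (auto simp: field_simps)
    have "\<forall>\<^sub>F n in sequentially. \<forall>i\<in>I. \<forall>j\<in>I. \<mu> i \<noteq> \<mu> j \<longrightarrow>
        F (tv_dist (\<mu> i) (\<mu> j)) + (1 - 1 / c) ^ n \<le> 2 * tv_dist (\<mu> i) (\<mu> j)"
    proof (intro eventually_ball_finite fin ballI)
      fix i j assume i: "i \<in> I" and j: "j \<in> I"
      let ?d = "tv_dist (\<mu> i) (\<mu> j)"
      show "\<forall>\<^sub>F n in sequentially. \<mu> i \<noteq> \<mu> j \<longrightarrow> F ?d + (1 - 1 / c) ^ n \<le> 2 * ?d"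
      proof (cases "\<mu> i = \<mu> j")
        case False
        then have "0 < ?d"
          using tv_dist_nonneg[OF ps[OF i] ps[OF j]] tv_dist_eq_0D[OF ps[OF i] ps[OF j]] sets_\<mu> i j
          by fastforce
        then have "F ?d < 2 * ?d"
          by (simp add: F_def field_simps)
        then have "\<forall>\<^sub>F n in sequentially. (1 - 1 / c) ^ n < 2 * ?d - F ?d"
          by (intro order_tendstoD(2)[OF lim]) simp
        then show ?thesis
          by eventually_elim simp
      qed simp
    qed
    then obtain n where n: "\<And>i j. i \<in> I \<Longrightarrow> j \<in> I \<Longrightarrow> \<mu> i \<noteq> \<mu> j \<Longrightarrow>
        F (tv_dist (\<mu> i) (\<mu> j)) + (1 - 1 / c) ^ n \<le> 2 * tv_dist (\<mu> i) (\<mu> j)"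
      by (auto simp: eventually_sequentially)
    have "coupled_within I \<mu> (\<lambda>i j. 2 * tv_dist (\<mu> i) (\<mu> j))"
      using n tv_dist_nonneg[OF ps ps] by (intro coupled_within_mono[OF approx[of n]]) auto
    then show ?thesis
      by (rule coupled_within_min_1)
  qed
  then show "\<exists>(\<Omega> :: (nat \<Rightarrow> 'b) measure) X. is_coupling I \<mu> \<Omega> X \<and>
    (\<forall>i\<in>I. \<forall>j\<in>I. i \<noteq> j \<longrightarrow> {\<omega> \<in> space \<Omega>. X i \<omega> \<noteq> X j \<omega>} \<in> sets \<Omega> \<and>
       measure \<Omega> {\<omega> \<in> space \<Omega>. X i \<omega> \<noteq> X j \<omega>} \<le> min (2 * tv_dist (\<mu> i) (\<mu> j)) 1)"
    unfolding coupled_within_def by blast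
qed

subsection \<open>The lower bound\<close>

text \<open>Pairs are ordered, whence the factor 2. Every index disagrees with \<open>a\<close> or
  with \<open>b\<close>, so these two rows contain at least \<open>n + 1\<close> pairs together; for
  the same reason each of the other \<open>n - 1\<close> rows contains at least one.\<close>

lemma card_disagreeing_pairs_ge:
  fixes x :: "nat \<Rightarrow> 'a"
  assumes "a \<le> n" "b \<le> n" "x a \<noteq> x b"
  shows "2 * n \<le> (\<Sum>i\<le>n. card {j. j \<le> n \<and> x i \<noteq> x j})"
proof -
  define c where "c i = card {j. j \<le> n \<and> x i \<noteq> x j}" for i
  have "a \<noteq> b"
    using assms(3) by auto
  have fin: "finite {j. j \<le> n \<and> P j}" for P
    by simp
  have "{..n} \<subseteq> {j. j \<le> n \<and> x a \<noteq> x j} \<union> {j. j \<le> n \<and> x b \<noteq> x j}"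
    using assms(3) by auto
  then have "card {..n} \<le> card ({j. j \<le> n \<and> x a \<noteq> x j} \<union> {j. j \<le> n \<and> x b \<noteq> x j})"
    by (intro card_mono) auto
  also have "\<dots> \<le> c a + c b"
    unfolding c_def by (rule card_Un_le)
  finally have ab: "n + 1 \<le> c a + c b"
    by simp
  have one: "1 \<le> c i" for i
  proof -
    have "{j. j \<le> n \<and> x i \<noteq> x j} \<noteq> {}"
      using assms by (cases "x i = x a") auto
    then show ?thesis
      unfolding c_def using card_gt_0_iff fin by (metis Suc_leI One_nat_def)
  qed
  have card: "card ({..n} - {a, b}) = n - 1"
    using assms \<open>a \<noteq> b\<close> by (subst card_Diff_subset) auto
  have "n - 1 \<le> (\<Sum>i\<in>{..n} - {a, b}. c i)"
    using sum_mono[of "{..n} - {a, b}" "\<lambda>_. 1" c] one card by simp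
  moreover have "(\<Sum>i\<le>n. c i) = (\<Sum>i\<in>{a, b}. c i) + (\<Sum>i\<in>{..n} - {a, b}. c i)"
    using assms by (subst sum.subset_diff[of "{a, b}"]) auto
  moreover have "(\<Sum>i\<in>{a, b}. c i) = c a + c b"
    using \<open>a \<noteq> b\<close> by simp
  ultimately show ?thesis
    using ab unfolding c_def by linarith
qed

section \<open>Uniform laws on a finite set with one point removed\<close>

text \<open>The count over all of \<open>V\<close> is kept in the numerator so that it cancels when
  two removed points are compared.\<close>

lemma measure_pmf_of_set_remove:
  assumes "finite V" "x \<in> V" "V \<noteq> {x}"
  shows "measure (measure_pmf (pmf_of_set (V - {x}))) A =
    (real (card (V \<inter> A)) - indicator A x) / (real (card V) - 1)"
proof -
  have "V - {x} \<noteq> {}" "finite (V - {x})"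
    using assms by auto
  moreover have "real (card (V - {x})) = real (card V) - 1"
    using card_Suc_Diff1[OF assms(1,2)] by linarith
  moreover have "real (card ((V - {x}) \<inter> A)) = real (card (V \<inter> A)) - indicator A x"
  proof (cases "x \<in> A")
    case True
    then have "(V - {x}) \<inter> A = V \<inter> A - {x}" "x \<in> V \<inter> A"
      using assms by auto
    then show ?thesis
      using True assms(1) card_Suc_Diff1[of "V \<inter> A" x] by simp
  next
    case False
    then have "(V - {x}) \<inter> A = V \<inter> A" by auto
    with False show ?thesis by simp
  qed
  ultimately show ?thesis
    by (simp add: measure_pmf_of_set)
qed

text \<open>After cancellation the numerator only sees whether \<open>x\<close> and \<open>y\<close>
  lie in \<open>A\<close>; it is at most 1, and \<open>A = {y}\<close> attains this.\<close>

lemma tv_dist_pmf_of_set_remove: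
  assumes "finite V" "x \<in> V" "y \<in> V" "x \<noteq> y"
  shows "tv_dist (measure_pmf (pmf_of_set (V - {x}))) (measure_pmf (pmf_of_set (V - {y}))) =
    1 / (real (card V) - 1)"
proof -
  have V: "V \<noteq> {x}" "V \<noteq> {y}"
    using assms by auto
  have "card {x, y} \<le> card V"
    using assms by (intro card_mono) auto
  then have pos: "real (card V) - 1 > 0"
    using assms(4) by simp
  have *: "\<bar>measure (measure_pmf (pmf_of_set (V - {x}))) A -
      measure (measure_pmf (pmf_of_set (V - {y}))) A\<bar> =
      \<bar>indicator A y - indicator A x\<bar> / (real (card V) - 1)" for A
    using pos assms V by (simp add: measure_pmf_of_set_remove diff_divide_distrib[symmetric] abs_divide)
  show ?thesis
    unfolding tv_dist_def *
  proof (rule cSup_eq_maximum)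
    show "1 / (real (card V) - 1) \<in> (\<lambda>A. \<bar>indicator A y - indicator A x\<bar> / (real (card V) - 1)) `
        sets (measure_pmf (pmf_of_set (V - {x})))"
      using assms(4) by (intro image_eqI[of _ _ "{y}"]) auto
    show "z \<le> 1 / (real (card V) - 1)" if "z \<in> (\<lambda>A. \<bar>indicator A y - indicator A x\<bar> /
        (real (card V) - 1)) ` sets (measure_pmf (pmf_of_set (V - {x})))" for z
      using that pos by (auto simp: divide_right_mono indicator_def)
  qed
qed

section \<open>Averaging over pairs, and sharpness of the constant 2\<close>

text \<open>The expected number of ordered disagreeing pairs is at least \<open>2 * n\<close> and at
  most \<open>(n + 1) * n * f (1 / n)\<close>. Infinitely many values are assumed so that
  \<open>n + 1\<close> distinct points exist for every \<open>n\<close>.\<close>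

lemma disagreement_bound_ge:
  assumes inf: "infinite (UNIV :: 'a set)" and bound: "disagreement_bound TYPE('a) f"
    and n: "1 \<le> n"
  shows "2 / (real n + 1) \<le> f (1 / real n)"
proof -
  obtain g :: "nat \<Rightarrow> 'a" where g: "inj g"
    using infinite_countable_subset[OF inf] by blast
  \<comment> \<open>There are \<open>n + 1\<close> points, so each law is uniform on
    \<open>n\<close> of them and the distances are \<open>1 / n\<close>.\<close>
  define V where "V = g ` {..n}"
  have V: "finite V" "card V = n + 1"
    using g by (auto simp: V_def card_image inj_on_subset)
  define \<nu> where "\<nu> i = measure_pmf (pmf_of_set (V - {g i}))" for i
  have gV: "g i \<in> V" if "i \<le> n" for i
    using that by (auto simp: V_def)
  have tv: "tv_dist (\<nu> i) (\<nu> j) = 1 / real n" if "i \<le> n" "j \<le> n" "i \<noteq> j" for i j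
    using tv_dist_pmf_of_set_remove[OF V(1) gV gV] that V(2) g by (simp add: \<nu>_def inj_eq)
  have "\<forall>i\<in>{..n}. prob_space (\<nu> i) \<and> sets (\<nu> i) = sets (count_space UNIV)"
    by (simp add: \<nu>_def prob_space_measure_pmf)
  then obtain \<Omega> :: "(nat \<Rightarrow> 'a) measure" and X where coup: "is_coupling {..n} \<nu> \<Omega> X"
    and D: "\<And>i j. i \<le> n \<Longrightarrow> j \<le> n \<Longrightarrow> i \<noteq> j \<Longrightarrow> {\<omega> \<in> space \<Omega>. X i \<omega> \<noteq> X j \<omega>} \<in> sets \<Omega> \<and>
       measure \<Omega> {\<omega> \<in> space \<Omega>. X i \<omega> \<noteq> X j \<omega>} \<le> f (tv_dist (\<nu> i) (\<nu> j))"
    using bound[unfolded disagreement_bound_def, THEN conjunct2, rule_format, of "{..n}" \<nu> "count_space UNIV"]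
    by (auto simp: Ball_def)
  interpret prob_space \<Omega>
    using coup by (simp add: is_coupling_def)
  define d where "d i j = {\<omega> \<in> space \<Omega>. X i \<omega> \<noteq> X j \<omega>}" for i j
  have d_sets: "d i j \<in> sets \<Omega>" if "i \<le> n" "j \<le> n" for i j
    using D[OF that] by (cases "i = j") (auto simp: d_def)
  have in_V: "AE \<omega> in \<Omega>. X i \<omega> \<in> V - {g i}" if i: "i \<le> n" for i
  proof -
    have X: "X i \<in> measurable \<Omega> (\<nu> i)" and law: "distr \<Omega> (\<nu> i) (X i) = \<nu> i"
      using coup i by (auto simp: is_coupling_def)
    have "V - {g i} \<noteq> {}"
    proof
      assume "V - {g i} = {}"
      then have "card V \<le> card {g i}" by (intro card_mono) auto
      then show False using V(2) n by simp
    qed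
    then have "AE x in \<nu> i. x \<in> V - {g i}"
      using V(1) by (subst \<nu>_def, subst AE_measure_pmf_iff, subst set_pmf_of_set) auto
    then have "AE x in distr \<Omega> (\<nu> i) (X i). x \<in> V - {g i}"
      by (simp only: law)
    then show ?thesis
      by (rule AE_distrD[OF X])
  qed
  have "AE \<omega> in \<Omega>. \<forall>i\<in>{..n}. X i \<omega> \<in> V - {g i}"
    using in_V by (intro AE_finite_allI) auto
  then have "AE \<omega> in \<Omega>. real (2 * n) \<le> (\<Sum>i\<le>n. \<Sum>j\<le>n. indicator (d i j) \<omega>)"
    using AE_space
  proof eventually_elim
    case (elim \<omega>)
    \<comment> \<open>The value of \<open>X 0\<close> is the point forbidden to \<open>X b\<close>,
      so \<open>0\<close> and \<open>b\<close> are the two disagreeing indices required by the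
      count.\<close>
    obtain b where b: "b \<le> n" "X 0 \<omega> = g b"
      using elim(1) by (auto simp: V_def)
    have "X b \<omega> \<noteq> g b"
      using elim(1) b(1) by auto
    then have "X 0 \<omega> \<noteq> X b \<omega>"
      using b(2) by simp
    then have "2 * n \<le> (\<Sum>i\<le>n. card {j. j \<le> n \<and> X i \<omega> \<noteq> X j \<omega>})"
      using card_disagreeing_pairs_ge[of 0 n b "\<lambda>i. X i \<omega>"] b(1) by simp
    then have "real (2 * n) \<le> real (\<Sum>i\<le>n. card {j. j \<le> n \<and> X i \<omega> \<noteq> X j \<omega>})"
      by (simp only: of_nat_le_iff)
    also have "\<dots> = (\<Sum>i\<le>n. \<Sum>j\<le>n. indicator (d i j) \<omega>)"
      unfolding of_nat_sum
    proof (rule sum.cong)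
      fix i
      have "(\<Sum>j\<le>n. indicator (d i j) \<omega> :: real) =
          (\<Sum>j\<le>n. if X i \<omega> \<noteq> X j \<omega> then 1 else 0)"
        using elim(2) by (intro sum.cong) (auto simp: d_def)
      also have "\<dots> = real (card ({..n} \<inter> {j. X i \<omega> \<noteq> X j \<omega>}))"
        by (subst sum.If_cases) auto
      also have "{..n} \<inter> {j. X i \<omega> \<noteq> X j \<omega>} = {j. j \<le> n \<and> X i \<omega> \<noteq> X j \<omega>}"
        by auto
      finally show "real (card {j. j \<le> n \<and> X i \<omega> \<noteq> X j \<omega>}) = (\<Sum>j\<le>n. indicator (d i j) \<omega>)"
        by simp
    qed simp
    finally show ?case .
  qed
  moreover have int: "integrable \<Omega> (indicat_real (d i j))" if "i \<le> n" "j \<le> n" for i j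
    using d_sets[OF that] by (simp add: integrable_indicator_iff less_top[symmetric])
  ultimately have "real (2 * n) \<le> expectation (\<lambda>\<omega>. \<Sum>i\<le>n. \<Sum>j\<le>n. indicator (d i j) \<omega>)"
    by (intro integral_ge_const Bochner_Integration.integrable_sum) auto
  also have "\<dots> = (\<Sum>i\<le>n. expectation (\<lambda>\<omega>. \<Sum>j\<le>n. indicator (d i j) \<omega>))"
    using int by (intro Bochner_Integration.integral_sum Bochner_Integration.integrable_sum) auto
  also have "\<dots> = (\<Sum>i\<le>n. \<Sum>j\<le>n. expectation (indicator (d i j)))"
    using int by (intro sum.cong refl Bochner_Integration.integral_sum) auto
  also have "\<dots> = (\<Sum>i\<le>n. \<Sum>j\<le>n. prob (d i j))"
    using d_sets by (simp add: Int_absorb2 sets.sets_into_space)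
  \<comment> \<open>The coupling bounds only pairs of different indices; the diagonal sets are
    empty, leaving \<open>n\<close> terms in each row.\<close>
  also have "\<dots> \<le> (\<Sum>i\<le>n. \<Sum>j\<le>n. if i = j then 0 else f (1 / real n))"
    using D tv by (intro sum_mono) (auto simp: d_def)
  also have "\<dots> = (\<Sum>i\<le>n. real n * f (1 / real n))"
  proof (rule sum.cong)
    fix i assume "i \<in> {..n}"
    then have "(\<Sum>j\<le>n. if i = j then 0 else f (1 / real n)) =
        (\<Sum>j\<in>{..n} - {i}. f (1 / real n))"
      by (subst sum.remove[of _ i]) (auto intro!: sum.cong)
    with \<open>i \<in> {..n}\<close> show "(\<Sum>j\<le>n. if i = j then 0 else f (1 / real n)) = real n * f (1 / real n)"
      by simp
  qed simp
  finally have "real n * 2 \<le> real n * ((real n + 1) * f (1 / real n))"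
    by (simp add: algebra_simps)
  then have "2 \<le> (real n + 1) * f (1 / real n)"
    using n by simp
  then show ?thesis
    by (simp add: pos_divide_le_eq algebra_simps)
qed

text \<open>At \<open>1 / n\<close> the lower bound forces \<open>a \<ge> 2 * n / (n + 1)\<close>,
  and the right side tends to 2.\<close>

lemma not_disagreement_bound_less_2:
  assumes inf: "infinite (UNIV :: 'a set)" and a: "a < 2"
  shows "\<not> disagreement_bound TYPE('a) (\<lambda>x. min (a * x) 1)"
proof
  assume bound: "disagreement_bound TYPE('a) (\<lambda>x. min (a * x) 1)"
  have "2 * (real n / (real n + 1)) \<le> a" if "1 \<le> n" for n
    using disagreement_bound_ge[OF inf bound that] that by (simp add: field_simps)
  moreover have "(\<lambda>n. 2 * (real n / (real n + 1))) \<longlonglongrightarrow> 2 * 1"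
    using LIMSEQ_n_over_Suc_n by (intro tendsto_mult) (simp_all add: add.commute)
  ultimately have "2 * 1 \<le> a"
    by (intro LIMSEQ_le_const2) auto
  with a show False by simp
qed

theorem proposition7:
  assumes "infinite (UNIV :: 'a set)"
  shows "(\<forall>f. disagreement_bound TYPE('a) f \<longrightarrow>
            (\<forall>n::nat. n \<ge> 1 \<longrightarrow>
               f (1 / real n) \<ge> 2 / (real n + 1) \<and> 2 / (real n + 1) = F (1 / real n))) \<and>
         disagreement_bound TYPE('b) (\<lambda>x. min (2 * x) 1) \<and>
         (\<forall>a::real. a < 2 \<longrightarrow> \<not> disagreement_bound TYPE('a) (\<lambda>x. min (a * x) 1))"
  using disagreement_bound_ge[OF assms] not_disagreement_bound_less_2[OF assms]
    disagreement_bound_double[where 'b = 'b]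
  by (auto simp: F_def divide_simps)

end
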